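(* Let $X$ be a nonempty finite set, let $\beta \in (0,1)$, and let $f : X \to [0,1]$ be a nonconstant function such that $f(x) < 1$ for all $x \in X$. There exists a function $g : X \to [0,1]$ that is both an F-proxy for $f$ (with parameter $\beta$) and catastrophic for $f$ if and only if $\beta \geq 1/|X|$.
   Context: $X$ is a finite set (with its discrete Borel structure), $A=[0,1]$, $\mathcal M(X,A)$ is the set of (Borel measurable, here all) functions $X \to A$, and $\Delta(X)$ is the set of probability distributions on $X$. F-proxy: $g : X \to [0,1]$ is an F-proxy for $f$ when $\Pr_{x \sim \mathcal U(X)}[g(x) \neq f(x)] \leq \beta$, where $\mathcal U(X)$ is the uniform distribution on $X$. Optimizer: a map $\Omega : \mathbb R_{\geq 0} \times \mathcal M(X,A) \times \Delta(X) \to \Delta(X)$, written $(k,g,p) \mapsto \Omega_k(g,p)$, such that for all $g \in \mathcal M(X,A)$ and $p \in \Delta(X)$: (1) $\Omega_0(g,p) = p$; (2) $j<k$ implies $\mathbb E_{x\sim\Omega_j(g,p)}[g(x)] \leq \mathbb E_{x\sim\Omega_k(g,p)}[g(x)]$; (3) for all $M < \sup_{y\in X} g(y)$, $\lim_{k\to\infty} \Pr_{x\sim\Omega_k(g,p)}[g(x) > M] = 1$; (4) $\lim_{k\to\infty} \mathbb E_{x\sim\Omega_k(g,p)}[g(x)] = \sup_{y\in X} g(y)$. $\eta$-catastrophic: for a real number $\eta$ with $\inf_{y\in X} f(y) \leq \eta < \sup_{y\in X} f(y)$, a value function $g$ is $\eta$-catastrophic for $f$ when for all initial priors $p \in \Delta(X)$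 and all optimizers $\Omega$, $\limsup_{k\to\infty} \mathbb E_{x\sim\Omega_k(g,p)}[f(x)] \leq \eta$. It is catastrophic for $f$ when it is $\eta$-catastrophic for $f$ with $\eta = \inf_{y\in X} f(y)$. *)

theory Defs
  imports "HOL-Probability.Probability"
begin

text \<open>
  The finite nonempty set \<open>X\<close> is the universe of a type of class \<open>finite\<close>, so \<open>\<Delta>(X)\<close> is
  \<open>'x pmf\<close>, and the uniform distribution on \<open>X\<close> is \<open>pmf_of_set UNIV\<close>.
\<close>

definition value_functions :: "('x \<Rightarrow> real) set" where
  "value_functions = (UNIV \<rightarrow> {0..1})"

definition F_proxy :: "real \<Rightarrow> ('x::finite \<Rightarrow> real) \<Rightarrow> ('x \<Rightarrow> real) \<Rightarrow> bool" where
  "F_proxy \<beta> f g \<longleftrightarrow> measure_pmf.prob (pmf_of_set UNIV) {x. g x \<noteq> f x} \<le> \<beta>"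

text \<open>
  An optimizer has domain \<open>\<real>\<^sub>\<ge>\<^sub>0 \<times> value_functions \<times> \<Delta>(X)\<close>. It is represented by a total function whose
  values at negative \<open>k\<close> or at \<open>g\<close> outside \<^const>\<open>value_functions\<close> are unconstrained; these values
  are never used.
\<close>

definition optimizer :: "(real \<Rightarrow> ('x::finite \<Rightarrow> real) \<Rightarrow> 'x pmf \<Rightarrow> 'x pmf) \<Rightarrow> bool" where
  "optimizer \<Omega> \<longleftrightarrow> (\<forall>g\<in>value_functions. \<forall>p.
     \<Omega> 0 g p = p \<and>
     (\<forall>j k. 0 \<le> j \<and> j < k \<longrightarrow>
        measure_pmf.expectation (\<Omega> j g p) g \<le> measure_pmf.expectation (\<Omega> k g p) g) \<and>
     (\<forall>M < (SUP y. g y). ((\<lambda>k. measure_pmf.prob (\<Omega> k g p) {x. g x > M}) \<longlongrightarrow> 1) at_top) \<and>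
     ((\<lambda>k. measure_pmf.expectation (\<Omega> k g p) g) \<longlongrightarrow> (SUP y. g y)) at_top)"

text \<open>
  The limit superior is taken in the extended reals because \<^const>\<open>Limsup\<close> needs a complete lattice.
\<close>

definition eta_catastrophic ::
    "real \<Rightarrow> ('x::finite \<Rightarrow> real) \<Rightarrow> ('x \<Rightarrow> real) \<Rightarrow> bool" where
  "eta_catastrophic \<eta> f g \<longleftrightarrow>
     (INF y. f y) \<le> \<eta> \<and> \<eta> < (SUP y. f y) \<and>
     (\<forall>p \<Omega>. optimizer \<Omega> \<longrightarrow>
        Limsup at_top (\<lambda>k. ereal (measure_pmf.expectation (\<Omega> k g p) f)) \<le> ereal \<eta>)"

definition catastrophic :: "('x::finite \<Rightarrow> real) \<Rightarrow> ('x \<Rightarrow> real) \<Rightarrow> bool" where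
  "catastrophic f g \<longleftrightarrow> eta_catastrophic (INF y. f y) f g"

end

theory Submission
  imports Defs
begin

text \<open>
  If \<open>\<beta> \<ge> 1/|X|\<close>, raising \<open>f\<close> to the value 1 at a single minimizer \<open>x\<^sub>0\<close> of \<open>f\<close> makes \<open>x\<^sub>0\<close> the unique
  maximizer of the resulting proxy, separated from all other points; condition (3) then forces every
  optimizer to concentrate on \<open>x\<^sub>0\<close>. If \<open>\<beta> < 1/|X|\<close>, the only F-proxy for \<open>f\<close> is \<open>f\<close> itself, and
  condition (4), for any optimizer whatsoever, drives the expectation of \<open>f\<close> to
  \<open>sup f > inf f\<close>.
\<close>

lemma finite_SUP_attained:
  fixes g :: "'x::finite \<Rightarrow> real"
  obtains x where "g x = (SUP y. g y)"
proof -
  have "Max (range g) \<in> range g" by (rule Max_in) auto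
  then show ?thesis using that by (metis cSup_eq_Max empty_not_UNIV finite finite_imageI image_is_empty rangeE)
qed

lemma finite_INF_attained:
  fixes g :: "'x::finite \<Rightarrow> real"
  obtains x where "g x = (INF y. g y)"
proof -
  have "Min (range g) \<in> range g" by (rule Min_in) auto
  then show ?thesis using that by (metis cInf_eq_Min empty_not_UNIV finite finite_imageI image_is_empty rangeE)
qed

lemma le_SUP_finite: "(g x :: real) \<le> (SUP y. g y)" for g :: "'x::finite \<Rightarrow> real"
  by (intro cSUP_upper) auto

lemma INF_le_finite: "(INF y. g y) \<le> (g x :: real)" for g :: "'x::finite \<Rightarrow> real"
  by (intro cINF_lower) auto

lemma expectation_le_SUP:
  fixes g :: "'x::finite \<Rightarrow> real"
  shows "measure_pmf.expectation p g \<le> (SUP y. g y)"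
proof -
  have "measure_pmf.expectation p g \<le> measure_pmf.expectation p (\<lambda>_. SUP y. g y)"
    by (intro integral_mono integrable_measure_pmf_finite le_SUP_finite) auto
  then show ?thesis by simp
qed

text \<open>Being catastrophic quantifies over all optimizers, so refuting it takes at least one.
  Since the supremum over a finite type is attained, it is enough to jump at once to a point mass at
  a maximizer.\<close>

lemma optimizer_exists: "\<exists>\<Omega>. optimizer (\<Omega> :: real \<Rightarrow> ('x::finite \<Rightarrow> real) \<Rightarrow> 'x pmf \<Rightarrow> 'x pmf)"
proof -
  have "\<forall>g :: 'x \<Rightarrow> real. \<exists>x. g x = (SUP y. g y)"
    using finite_SUP_attained by metis
  then obtain m :: "('x \<Rightarrow> real) \<Rightarrow> 'x" where m: "\<And>g. g (m g) = (SUP y. g y)"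
    by metis
  \<comment> \<open>Condition (1) forces the prior at \<open>k = 0\<close>; negative
    \<open>k\<close> falls in the same branch, where any value would do.\<close>
  define \<Omega> :: "real \<Rightarrow> ('x \<Rightarrow> real) \<Rightarrow> 'x pmf \<Rightarrow> 'x pmf"
    where "\<Omega> k g p = (if k \<le> 0 then p else return_pmf (m g))" for k g p
  have pos: "\<forall>\<^sub>F k in at_top. \<Omega> k g p = return_pmf (m g)" for g p
    using eventually_gt_at_top[of 0] by eventually_elim (simp add: \<Omega>_def)
  have "optimizer \<Omega>"
    unfolding optimizer_def
  proof (intro ballI allI conjI impI)
    fix g :: "'x \<Rightarrow> real" and p :: "'x pmf"
    show "\<Omega> 0 g p = p" by (simp add: \<Omega>_def)
    \<comment> \<open>The only jump is from \<open>j = 0\<close> to \<open>k > 0\<close>, where the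
      expectation under the prior is at most the supremum. For \<open>0 < j\<close> both sides equal
      the supremum.\<close>
    show "measure_pmf.expectation (\<Omega> j g p) g \<le> measure_pmf.expectation (\<Omega> k g p) g"
      if "0 \<le> j \<and> j < k" for j k
      using that expectation_le_SUP[of p g] by (auto simp: \<Omega>_def m)
    show "((\<lambda>k. measure_pmf.prob (\<Omega> k g p) {x. g x > M}) \<longlongrightarrow> 1) at_top"
      if "M < (SUP y. g y)" for M
    proof (rule tendsto_eventually)
      show "\<forall>\<^sub>F k in at_top. measure_pmf.prob (\<Omega> k g p) {x. g x > M} = 1"
        using pos[of g p] by eventually_elim (use that in \<open>simp add: m\<close>)
    qed
    show "((\<lambda>k. measure_pmf.expectation (\<Omega> k g p) g) \<longlongrightarrow> (SUP y. g y)) at_top"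
    proof (rule tendsto_eventually)
      show "\<forall>\<^sub>F k in at_top. measure_pmf.expectation (\<Omega> k g p) g = (SUP y. g y)"
        using pos[of g p] by eventually_elim (simp add: m)
    qed
  qed
  then show ?thesis by blast
qed

text \<open>Optimizing \<open>f\<close> itself drives its expectation to \<open>SUP y. f y\<close>
  by condition (4), while the definition puts the infimum strictly below that value. A single
  optimizer and an arbitrary prior give the contradiction.\<close>

lemma not_catastrophic_self:
  fixes f :: "'x::finite \<Rightarrow> real"
  assumes f: "f \<in> value_functions"
  shows "\<not> catastrophic f f"
proof
  assume "catastrophic f f"
  then have cat: "(INF y. f y) < (SUP y. f y)"
    "\<And>p \<Omega>. optimizer \<Omega> \<Longrightarrow>
      Limsup at_top (\<lambda>k. ereal (measure_pmf.expectation (\<Omega> k f p) f)) \<le> ereal (INF y. f y)"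
    by (auto simp: catastrophic_def eta_catastrophic_def)
  obtain \<Omega> :: "real \<Rightarrow> ('x \<Rightarrow> real) \<Rightarrow> 'x pmf \<Rightarrow> 'x pmf" where \<Omega>: "optimizer \<Omega>"
    using optimizer_exists by blast
  define p where "p = return_pmf (undefined :: 'x)"
  have "((\<lambda>k. measure_pmf.expectation (\<Omega> k f p) f) \<longlongrightarrow> (SUP y. f y)) at_top"
    using \<Omega> f by (simp add: optimizer_def)
  then have "Limsup at_top (\<lambda>k. ereal (measure_pmf.expectation (\<Omega> k f p) f)) = ereal (SUP y. f y)"
    by (intro lim_imp_Limsup tendsto_ereal) auto
  with cat(2)[OF \<Omega>, of p] cat(1) show False by simp
qed

lemma F_proxy_iff_card:
  fixes f g :: "'x::finite \<Rightarrow> real"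
  shows "F_proxy \<beta> f g \<longleftrightarrow> real (card {x. g x \<noteq> f x}) / real CARD('x) \<le> \<beta>"
  by (simp add: F_proxy_def measure_pmf_of_set)

text \<open>The disagreement probability is an integer multiple of \<open>1 / CARD('x)\<close>, so
  below one such unit it must vanish.\<close>

lemma F_proxy_small_imp_eq:
  fixes f g :: "'x::finite \<Rightarrow> real"
  assumes "F_proxy \<beta> f g" and "\<beta> < 1 / real CARD('x)"
  shows "g = f"
proof -
  have "real (card {x. g x \<noteq> f x}) / real CARD('x) < 1 / real CARD('x)"
    using assms by (simp add: F_proxy_iff_card)
  then have "card {x. g x \<noteq> f x} = 0"
    by (simp add: divide_less_cancel)
  then show ?thesis by auto
qed

lemma catastrophic_raise_minimizer:
  fixes f :: "'x::finite \<Rightarrow> real"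
  assumes f: "f \<in> value_functions" "\<exists>x y. f x \<noteq> f y" "\<forall>x. f x < 1"
    and x0: "f x0 = (INF y. f y)"
  shows "catastrophic f (f(x0 := 1))"
proof -
  define g where "g = f(x0 := 1)"
  \<comment> \<open>The threshold for condition (3). Since the supremum of \<open>f\<close> is
    attained, it stays strictly below 1, so it separates the raised point \<open>x0\<close> from
    every other point.\<close>
  define M where "M = (SUP y. f y)"
  have bounds: "0 \<le> f x" "f x < 1" for x
    using f by (auto simp: value_functions_def Pi_def)
  have g: "g \<in> value_functions"
    using f(1) by (auto simp: g_def value_functions_def)
  have fM: "f x \<le> M" for x
    unfolding M_def by (rule le_SUP_finite)
  have M1: "M < 1"
    using finite_SUP_attained[of f] f(3) by (metis M_def)
  then have "M < (SUP y. g y)"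
    using le_SUP_finite[of g x0] by (simp add: g_def)
  have level: "{x. g x > M} = {x0}"
    using M1 fM by (auto simp: g_def not_less[symmetric] split: if_splits)
  \<comment> \<open>Pointwise, the bound is equality at \<open>x0\<close>; elsewhere
    \<open>f x < 1\<close> and \<open>f x0 \<ge> 0\<close> give \<open>f x \<le> f x0 + 1\<close>.
    Hence the excess over the minimum is at most the mass away from \<open>x0\<close>.\<close>
  have le: "measure_pmf.expectation q f \<le> f x0 + (1 - measure_pmf.prob q {x0})" for q
  proof -
    have "measure_pmf.expectation q f \<le> measure_pmf.expectation q (\<lambda>x. f x0 + indicator (- {x0}) x)"
      using bounds
      by (intro integral_mono integrable_measure_pmf_finite)
         (auto simp: indicator_def add_increasing less_imp_le)
    also have "\<dots> = f x0 + measure_pmf.prob q (- {x0})"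
      by (subst Bochner_Integration.integral_add) (auto intro: integrable_measure_pmf_finite)
    also have "measure_pmf.prob q (- {x0}) = 1 - measure_pmf.prob q {x0}"
      using measure_pmf.prob_compl[of "{x0}" q] by (simp add: Compl_eq_Diff_UNIV)
    finally show ?thesis .
  qed
  have "Limsup at_top (\<lambda>k. ereal (measure_pmf.expectation (\<Omega> k g p) f)) \<le> ereal (f x0)"
    if "optimizer \<Omega>" for p \<Omega>
  proof -
    have "((\<lambda>k. measure_pmf.prob (\<Omega> k g p) {x0}) \<longlongrightarrow> 1) at_top"
      using that g \<open>M < (SUP y. g y)\<close> unfolding optimizer_def level[symmetric] by blast
    \<comment> \<open>As the mass at \<open>x0\<close> tends to 1, the majorant from
      \<open>le\<close> tends to \<open>f x0\<close>; monotonicity of \<open>Limsup\<close> carries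
      this over to the expectation of \<open>f\<close>.\<close>
    then have "((\<lambda>k. f x0 + (1 - measure_pmf.prob (\<Omega> k g p) {x0})) \<longlongrightarrow> f x0 + (1 - 1)) at_top"
      by (intro tendsto_intros)
    then have "Limsup at_top (\<lambda>k. ereal (f x0 + (1 - measure_pmf.prob (\<Omega> k g p) {x0})))
        = ereal (f x0 + (1 - 1))"
      by (intro lim_imp_Limsup tendsto_ereal) auto
    moreover have "Limsup at_top (\<lambda>k. ereal (measure_pmf.expectation (\<Omega> k g p) f))
        \<le> Limsup at_top (\<lambda>k. ereal (f x0 + (1 - measure_pmf.prob (\<Omega> k g p) {x0})))"
      using le by (intro Limsup_mono always_eventually allI) (simp del: plus_ereal.simps)
    ultimately show ?thesis by simp
  qed
  moreover have "(INF y. f y) < (SUP y. f y)"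
    using f(2) INF_le_finite[of f] le_SUP_finite[of f] by (meson antisym linorder_not_less order_trans)
  ultimately show ?thesis
    by (auto simp: catastrophic_def eta_catastrophic_def g_def x0)
qed

theorem theorem4p1:
  fixes f :: "'x::finite \<Rightarrow> real" and \<beta> :: real
  assumes "0 < \<beta>" and "\<beta> < 1"
    and "f \<in> value_functions"
    and "\<exists>x y. f x \<noteq> f y"
    and "\<forall>x. f x < 1"
  shows "(\<exists>g\<in>value_functions. F_proxy \<beta> f g \<and> catastrophic f g) \<longleftrightarrow> \<beta> \<ge> 1 / real CARD('x)"
proof
  assume "\<exists>g\<in>value_functions. F_proxy \<beta> f g \<and> catastrophic f g"
  then show "\<beta> \<ge> 1 / real CARD('x)"
    using F_proxy_small_imp_eq not_catastrophic_self[OF assms(3)] by (metis not_less)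
next
  assume \<beta>: "\<beta> \<ge> 1 / real CARD('x)"
  obtain x0 where x0: "f x0 = (INF y. f y)"
    using finite_INF_attained .
  \<comment> \<open>Because \<open>f x0 < 1\<close>, raising the value really changes
    \<open>f\<close>, and at exactly one point: the disagreement probability is one unit
    \<open>1 / CARD('x)\<close>.\<close>
  have "{x. (f(x0 := 1)) x \<noteq> f x} = {x0}"
    using assms(5) by (auto simp: less_le)
  then have "F_proxy \<beta> f (f(x0 := 1))"
    using \<beta> by (simp only: F_proxy_iff_card) simp
  moreover have "f(x0 := 1) \<in> value_functions"
    using assms(3) by (auto simp: value_functions_def)
  ultimately show "\<exists>g\<in>value_functions. F_proxy \<beta> f g \<and> catastrophic f g"
    using catastrophic_raise_minimizer[OF assms(3-5) x0] by blast
qed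

end
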